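(* Let $m$ be an odd positive integer and $k > 2$ an integer with $\sigma(m) = km$. Then: (i) if $k$ is odd, $\operatorname{rad}(m) \leq \sqrt{m}$; (ii) if $k \equiv 2 \pmod 4$, $\operatorname{rad}(m) < m^{9/14}$; (iii) otherwise, writing $k = 2^n t$ with $t$ odd and $n \geq 2$, $\operatorname{rad}(m) < m^{\frac{4n+1}{4n+4}}$.
   Context: $\sigma(m)$ is the sum of the positive divisors of $m$; $\operatorname{rad}(m)$ is the product of the distinct primes dividing $m$. In the paper, $m$ is called multiperfect (with abundancy $k$) if $\sigma(m) = km$ for an integer $k > 2$. *)

theory Defs
  imports Complex_Main "HOL-Number_Theory.Number_Theory"
begin

definition divisor_sum :: "nat \<Rightarrow> nat" where
  "divisor_sum m = (\<Sum>d | d dvd m. d)"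

definition rad :: "nat \<Rightarrow> nat" where
  "rad m = \<Prod>(prime_factors m)"

end

theory Submission
  imports Defs
begin

text \<open>
  Let \<open>Q\<close> be the set of primes dividing \<open>m\<close> exactly once. Each contributes a factor 2 to
  \<open>\<sigma>(m) = k m\<close>, so \<open>|Q| \<le> n\<close> when \<open>2\<^sup>n\<close> exactly divides \<open>k\<close>; the rest of \<open>m\<close> is powerful, so its
  radical is at most its square root. The task is to show that the powerful part is large. Since
  \<open>\<sigma>(m)/m\<close> is at least \<open>2\<^sup>n\<close> (or 6), \<open>m\<close> has so many prime factors that a few of them can be spared to
  absorb all constants.

  The largest \<open>q \<in> Q\<close> divides \<open>\<sigma>(p\<^sup>a)\<close> for some \<open>p\<^sup>a\<close> in the powerful part. If \<open>a \<ge> 3\<close>, the gap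
  between \<open>p\<close> and \<open>p\<^bsup>a/2\<^esup>\<close> already suffices (for \<open>a = 3\<close> because \<open>q\<close> divides \<open>(p + 1)(p\<^sup>2 + 1)\<close>). If \<open>a = 2\<close>, then \<open>p\<^sup>2\<close> divides \<open>\<sigma>(m)\<close>, and either its factors
  \<open>p\<close> come from the other prime powers of the powerful part, forcing those to be large, or \<open>p\<close>
  divides \<open>s + 1\<close> for some \<open>s \<in> Q\<close>. In the latter case one climbs from \<open>s\<close> through primes of
  \<open>Q\<close>, each dividing the successor of the next. The climb ends either at a prime of \<open>Q\<close> other than \<open>q\<close>
  that divides \<open>\<sigma>\<close> of another powerful prime power, or at \<open>q\<close>, and then a congruence modulo \<open>p\<close>
  forces \<open>s = 2p - 1\<close>.
\<close>

section \<open>Divisor sums\<close>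

lemma divisor_sum_mult_coprime:
  assumes "coprime a b"
  shows "divisor_sum (a * b) = divisor_sum a * divisor_sum b"
proof -
  have "inj_on (\<lambda>(x, y). x * y) ({d. d dvd a} \<times> {d. d dvd b})"
  proof (rule inj_onI, clarsimp)
    fix x y x' y' assume *: "x dvd a" "y dvd b" "x' dvd a" "y' dvd b" "x * y = x' * y'"
    have "coprime x y'" "coprime x' y" "coprime x y" "coprime x' y'"
      using * assms by (meson coprime_divisors)+
    then show "x = x' \<and> y = y'"
      using *(5) by (metis coprime_crossproduct_nat mult.commute)
  qed
  moreover have "(\<lambda>(x, y). x * y) ` ({d. d dvd a} \<times> {d. d dvd b}) = {d. d dvd a * b}"
  proof (intro equalityI subsetI)
    fix d assume "d \<in> {d. d dvd a * b}"
    then obtain x y where "d = x * y" "x dvd a" "y dvd b" using division_decomp[of d a b] by blast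
    then show "d \<in> (\<lambda>(x, y). x * y) ` ({d. d dvd a} \<times> {d. d dvd b})"
      by (intro image_eqI[of _ _ "(x, y)"]) simp_all
  qed (auto intro: mult_dvd_mono)
  ultimately have "divisor_sum (a * b) = (\<Sum>(x, y)\<in>{d. d dvd a} \<times> {d. d dvd b}. x * y)"
    unfolding divisor_sum_def by (intro sum.reindex_cong[where l = "\<lambda>(x, y). x * y"]) auto
  then show ?thesis
    by (simp add: divisor_sum_def sum_product sum.cartesian_product)
qed

lemma divisor_sum_prime_power:
  assumes "prime p"
  shows "divisor_sum (p ^ n) = (\<Sum>i\<le>n. p ^ i)"
proof -
  have "{d. d dvd p ^ n} = (\<lambda>i. p ^ i) ` {..n}"
    using divides_primepow_nat[OF assms] by auto
  moreover have "inj_on (\<lambda>i. p ^ i) {..n}"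
    using prime_gt_1_nat[OF assms] by (auto intro!: inj_onI)
  ultimately show ?thesis
    by (simp add: divisor_sum_def sum.reindex)
qed

lemma divisor_sum_prod_prime_powers:
  assumes "finite A" and "\<And>p. p \<in> A \<Longrightarrow> prime p"
  shows "divisor_sum (\<Prod>p\<in>A. p ^ e p) = (\<Prod>p\<in>A. \<Sum>i\<le>e p. p ^ i)"
  using assms
proof (induction A rule: finite_induct)
  case empty
  then show ?case by (simp add: divisor_sum_def)
next
  case (insert x A)
  have "coprime (x ^ e x) (\<Prod>p\<in>A. p ^ e p)"
    using insert by (intro prod_coprime_right) (metis coprime_power_left_iff coprime_power_right_iff
        insert_iff primes_coprime)
  then show ?case
    using insert by (simp add: divisor_sum_mult_coprime divisor_sum_prime_power)
qed

lemma geometric_sum_nat: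
  fixes l :: nat
  assumes "l > 0"
  shows "(l - 1) * (\<Sum>i\<le>n. l ^ i) + 1 = l * l ^ n"
proof (induction n)
  case 0
  then show ?case using assms by simp
next
  case (Suc n)
  then show ?case using assms by (cases l) (auto simp: algebra_simps)
qed

text \<open>The ratio of the sum to \<open>l ^ n\<close> is below \<open>l / (l - 1)\<close>, which
  is at most \<open>(c + 1) / c\<close> for positive \<open>c\<close>. Writing
  \<open>l = c + 1 + j\<close> avoids subtraction.\<close>

lemma geometric_sum_less:
  fixes l c :: nat
  assumes "c < l"
  shows "c * (\<Sum>i\<le>n. l ^ i) < (c + 1) * l ^ n"
proof -
  obtain j where l: "l = c + 1 + j" using assms by (metis less_iff_Suc_add add_Suc_right add.commute Suc_eq_plus1)
  let ?g = "\<Sum>i\<le>n. l ^ i"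
  have "l ^ n \<le> ?g" by (intro member_le_sum) auto
  then have "j * l ^ n \<le> j * ?g" by simp
  moreover have "c * ?g + j * ?g + 1 = (c + 1) * l ^ n + j * l ^ n"
    using geometric_sum_nat[of l n] by (simp add: l algebra_simps)
  ultimately show ?thesis by linarith
qed

text \<open>Removing one term divisible by \<open>p\<close> leaves a product that is either still
  divisible by \<open>p\<close> or coprime to \<open>p ^ 2\<close>; in the latter case the removed
  term takes the whole square.\<close>

lemma prime_square_dvd_prod:
  fixes p :: nat
  assumes "prime p" "finite A" "p ^ 2 dvd (\<Prod>l\<in>A. h l)"
  shows "\<exists>l\<in>A. p dvd h l \<and> (p ^ 2 dvd h l \<or> (\<exists>l'\<in>A. l' \<noteq> l \<and> p dvd h l'))"
proof -
  have "p dvd (\<Prod>l\<in>A. h l)" using assms(3) by (metis dvd_mult_left power2_eq_square)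
  then obtain l where l: "l \<in> A" "p dvd h l"
    using assms prime_dvd_prod_iff by metis
  show ?thesis
  proof (cases "p dvd (\<Prod>l\<in>A - {l}. h l)")
    case True
    then obtain l' where "l' \<in> A - {l}" "p dvd h l'"
      using assms prime_dvd_prod_iff by (metis finite_Diff)
    then show ?thesis using l by blast
  next
    case False
    then have "coprime (p ^ 2) (\<Prod>l\<in>A - {l}. h l)"
      using assms(1) by (simp add: prime_imp_coprime)
    moreover have "p ^ 2 dvd h l * (\<Prod>l\<in>A - {l}. h l)"
      using assms l by (metis prod.remove)
    ultimately show ?thesis using l coprime_dvd_mult_left_iff by blast
  qed
qed

section \<open>Prime powers of an odd multiperfect number\<close>

text \<open>The number \<open>m\<close> enters only through its factorization: \<open>V\<close>
  holds its primes, \<open>e\<close> their exponents, and \<open>sigma_eq\<close> is sigma(m) = k m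
  in product form.\<close>

locale odd_multiperfect =
  fixes V :: "nat set" and e :: "nat \<Rightarrow> nat" and k :: nat
  assumes fin: "finite V"
    and prime_V: "l \<in> V \<Longrightarrow> prime l"
    and odd_V: "l \<in> V \<Longrightarrow> odd l"
    and e_pos: "l \<in> V \<Longrightarrow> e l > 0"
    and sigma_eq: "(\<Prod>l\<in>V. \<Sum>i\<le>e l. l ^ i) = k * (\<Prod>l\<in>V. l ^ e l)"
begin

text \<open>\<open>f l\<close> is the full power of \<open>l\<close> in \<open>m\<close> and
  \<open>g l\<close> its divisor sum. \<open>Q\<close> carries the primes dividing \<open>m\<close>
  exactly once, \<open>W\<close> those of the powerful part.\<close>

definition f :: "nat \<Rightarrow> nat" where "f l = l ^ e l"
definition g :: "nat \<Rightarrow> nat" where "g l = (\<Sum>i\<le>e l. l ^ i)"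
definition Q :: "nat set" where "Q = {l \<in> V. e l = 1}"
definition W :: "nat set" where "W = V - Q"

lemma prod_g: "prod g V = k * prod f V"
  using sigma_eq by (simp add: f_def g_def)

lemma fin_Q [simp]: "finite Q" and fin_W [simp]: "finite W"
  and QW_disj: "Q \<inter> W = {}" and QW_un: "V = Q \<union> W"
  using fin by (auto simp: Q_def W_def)

lemma V_ge3: "l \<in> V \<Longrightarrow> 3 \<le> l"
  using prime_V odd_V by (metis One_nat_def Suc_1 Suc_leI even_numeral le_neq_implies_less
      numeral_3_eq_3 prime_ge_2_nat)

lemma e_W: "l \<in> W \<Longrightarrow> 2 \<le> e l"
  using e_pos by (fastforce simp: Q_def W_def)

lemma f_pos: "l \<in> V \<Longrightarrow> 0 < f l"
  using V_ge3 by (fastforce simp: f_def)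

lemma f_W: "l \<in> W \<Longrightarrow> l ^ 2 \<le> f l"
  using e_W V_ge3[of l] unfolding f_def by (intro power_increasing) (auto simp: W_def)

lemma f_W9: "l \<in> W \<Longrightarrow> 9 \<le> f l"
proof -
  assume l: "l \<in> W"
  then have "3 ^ 2 \<le> l ^ 2" using V_ge3 by (intro power_mono) (auto simp: W_def)
  then show ?thesis using f_W[OF l] by simp
qed

lemma g_pos: "l \<in> V \<Longrightarrow> 0 < g l"
  unfolding g_def by (rule sum_pos2[of _ 0]) auto

lemma g_Q: "l \<in> Q \<Longrightarrow> g l = l + 1"
  by (simp add: Q_def g_def)

lemma g_le: "l \<in> V \<Longrightarrow> 2 * g l \<le> 3 * f l"
  using geometric_sum_less[of 2 l "e l"] V_ge3[of l] unfolding f_def g_def by simp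

lemma not_dvd_g: assumes "l \<in> V" shows "\<not> l dvd g l"
proof
  assume "l dvd g l"
  moreover have "(l - 1) * g l + 1 = l * f l"
    unfolding f_def g_def by (rule geometric_sum_nat) (use V_ge3[OF assms] in simp)
  ultimately have "l dvd 1"
    by (metis dvd_add_right_iff dvd_mult dvd_triv_left)
  then show False using V_ge3[OF assms] by simp
qed

text \<open>Converts divisibility into size: a divisor of a divisor sum forces the prime power
  behind it to be large.\<close>

lemma dvd_g_le: "l \<in> V \<Longrightarrow> x dvd g l \<Longrightarrow> 2 * x \<le> 3 * f l"
  using g_le[of l] g_pos[of l] dvd_imp_le[of x "g l"] by linarith

lemma dvd_prod_g: "x \<in> V \<Longrightarrow> f x dvd prod g V"
  unfolding prod_g using fin by (intro dvd_mult dvd_prodI)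

lemma ex_dvd_g: assumes "x \<in> V" shows "\<exists>l\<in>V. x dvd g l"
proof -
  have "x dvd f x" using e_pos[OF assms] by (simp add: f_def)
  then have "x dvd prod g V" using dvd_prod_g[OF assms] dvd_trans by blast
  then show ?thesis using prime_dvd_prod_iff[OF fin prime_V[OF assms]] by blast
qed

text \<open>Both primes are odd, so \<open>l + 1\<close> carries a factor 2 besides
  \<open>x\<close>. Hence steps from \<open>x\<close> to such an \<open>l\<close> go strictly
  upwards.\<close>

lemma dvd_succ_Q:
  assumes "x \<in> V" "l \<in> Q" "x dvd l + 1"
  shows "2 * x \<le> l + 1" and "x < l"
proof -
  have "coprime 2 x" using odd_V[OF assms(1)] by simp
  moreover have "2 dvd l + 1" using odd_V[of l] assms by (simp add: Q_def)
  ultimately have "2 * x dvd l + 1" using assms divides_mult by blast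
  then show *: "2 * x \<le> l + 1" by (rule dvd_imp_le) simp
  show "x < l" using * V_ge3[OF assms(1)] by linarith
qed

text \<open>Each \<open>l\<close> in \<open>Q\<close> contributes the even factor
  \<open>l + 1\<close> to k m; as \<open>m\<close> is odd, all these twos must fit into
  \<open>2 ^ n\<close>.\<close>

lemma card_Q_le:
  assumes "k = 2 ^ n * t" "odd t"
  shows "card Q \<le> n"
proof -
  have "(\<Prod>l\<in>Q. 2) dvd (\<Prod>l\<in>Q. g l)"
    using odd_V by (intro prod_dvd_prod) (auto simp: g_Q Q_def)
  also have "\<dots> dvd prod g V"
    using fin by (intro prod_dvd_prod_subset) (auto simp: Q_def)
  finally have "2 ^ card Q dvd 2 ^ n * (t * prod f V)"
    by (simp add: prod_g assms mult.assoc)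
  moreover have "odd (prod f V)"
    using fin odd_V by (auto simp: f_def prime_dvd_prod_iff)
  then have "coprime (2 ^ card Q) (t * prod f V)" using assms by simp
  ultimately have "(2::nat) ^ card Q dvd 2 ^ n"
    using coprime_dvd_mult_left_iff by blast
  then show ?thesis by (metis power_dvd_imp_le one_less_numeral_iff semiring_norm(76))
qed

text \<open>The prime 3 contributes a ratio of at most 3/2, every other prime at most 5/4. The
  factor 6/5 is the excess of 3/2 over 5/4.\<close>

lemma abundancy_le: "5 * 4 ^ card V * k \<le> 6 * 5 ^ card V"
proof -
  have *: "(\<Prod>l\<in>V - {3}. 4 * g l) \<le> (\<Prod>l\<in>V - {3}. 5 * f l)"
  proof (intro prod_mono conjI)
    fix l assume l: "l \<in> V - {3}"
    then have "4 < l" using V_ge3[of l] odd_V[of l] by (cases "l = 4") auto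
    then show "4 * g l \<le> 5 * f l"
      using geometric_sum_less[of 4 l "e l"] unfolding f_def g_def by simp
  qed simp
  have "5 * (\<Prod>l\<in>V. 4 * g l) \<le> 6 * (\<Prod>l\<in>V. 5 * f l)"
  proof (cases "3 \<in> V")
    case True
    have "5 * (4 * g 3) * (\<Prod>l\<in>V - {3}. 4 * g l) \<le> 6 * (5 * f 3) * (\<Prod>l\<in>V - {3}. 5 * f l)"
      using mult_le_mono[OF _ *, of "5 * (4 * g 3)" "6 * (5 * f 3)"] g_le[OF True] by simp
    then show ?thesis using fin True by (simp add: prod.remove mult.assoc)
  next
    case False
    then show ?thesis using * by simp
  qed
  then have "5 * (4 ^ card V * (k * prod f V)) \<le> 6 * (5 ^ card V * prod f V)"
    by (simp add: prod.distrib prod_g)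
  moreover have "prod f V > 0" using f_pos by (simp add: prod_pos)
  ultimately show ?thesis by (simp add: mult.assoc[symmetric])
qed

lemma card_V_ge:
  assumes "2 ^ n \<le> k" "2 \<le> n"
  shows "n + 4 \<le> card V"
proof (rule ccontr)
  assume "\<not> ?thesis"
  then have le: "card V \<le> n + 3" by simp
  \<comment> \<open>This contradicts the abundancy bound for \<open>n + 3\<close> primes, cleared of
    denominators. At \<open>n = 2\<close> it reads 3750 < 4096, and then the sides grow by 5 and by
    8.\<close>
  have "150 * 5 ^ n < (64::nat) * (4 ^ n * 2 ^ n)"
    using assms(2)
  proof (induction n rule: nat_induct_at_least)
    case (Suc n)
    then show ?case by simp
  qed simp
  \<comment> \<open>Padding with factors 4 reduces any smaller \<open>card V\<close> to the case of
    \<open>n + 3\<close> primes.\<close>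
  moreover have "(5::nat) ^ card V * 4 ^ (n + 3 - card V) \<le> 5 ^ card V * 5 ^ (n + 3 - card V)"
    by (intro mult_left_mono power_mono) auto
  then have "(5::nat) ^ card V * 4 ^ (n + 3 - card V) \<le> 5 ^ (n + 3)"
    using le by (simp flip: power_add)
  moreover have "5 * 4 ^ card V * 2 ^ n \<le> 6 * (5::nat) ^ card V"
    using abundancy_le mult_le_mono2[OF assms(1), of "5 * 4 ^ card V"] by linarith
  then have "5 * 4 ^ card V * 2 ^ n * 4 ^ (n + 3 - card V) \<le> 6 * (5::nat) ^ card V * 4 ^ (n + 3 - card V)"
    by (rule mult_le_mono1)
  moreover have "5 * 4 ^ card V * 2 ^ n * 4 ^ (n + 3 - card V)
      = 5 * (2::nat) ^ n * (4 ^ card V * 4 ^ (n + 3 - card V))"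
    by (simp only: mult_ac)
  moreover have "(4::nat) ^ card V * 4 ^ (n + 3 - card V) = 4 ^ (n + 3)"
    using le by (simp flip: power_add)
  ultimately have "5 * (2::nat) ^ n * 4 ^ (n + 3) \<le> 6 * 5 ^ (n + 3)" by simp
  then show False using \<open>150 * 5 ^ n < _\<close> by (simp add: power_add)
qed

text \<open>Seven primes give abundancy at most (6/5)(5/4)^7 < 5.73, short of 6.\<close>

lemma card_V_ge8:
  assumes "6 \<le> k"
  shows "8 \<le> card V"
proof (rule ccontr)
  assume "\<not> ?thesis"
  then have "card V \<in> {0,1,2,3,4,5,6,7}" by auto
  then show False using abundancy_le assms by auto
qed

lemma sq_prod_le: "A \<subseteq> W \<Longrightarrow> \<Prod>A ^ 2 \<le> prod f A"
  using f_W by (auto simp: prod_power_distrib intro!: prod_mono)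

lemma prod_f_sub: "A \<subseteq> B \<Longrightarrow> B \<subseteq> V \<Longrightarrow> prod f A \<le> prod f B"
  by (rule dvd_imp_le) (use fin f_pos in \<open>auto simp: finite_subset subset_iff
      intro!: prod_dvd_prod_subset prod_pos\<close>)

lemma prod_Q_le:
  assumes "card Q \<le> n" "\<And>x. x \<in> Q \<Longrightarrow> x \<le> q" "0 < q"
  shows "\<Prod>Q \<le> q ^ n"
proof -
  have "\<Prod>Q \<le> (\<Prod>x\<in>Q. q)" using assms by (intro prod_mono) auto
  also have "\<dots> \<le> q ^ n" using assms by (simp add: power_increasing)
  finally show ?thesis .
qed

text \<open>Keeping one member \<open>y\<close> instead of bounding it by \<open>q\<close> provides
  the saving needed when the exponent of \<open>p\<close> is 2.\<close>

lemma prod_Q_le':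
  assumes "card Q \<le> n" "\<And>x. x \<in> Q \<Longrightarrow> x \<le> q" "0 < q" "y \<in> Q"
  shows "\<Prod>Q \<le> q ^ (n - 1) * y"
proof -
  have "\<Prod>(Q - {y}) \<le> (\<Prod>x\<in>Q - {y}. q)" using assms by (intro prod_mono) auto
  also have "\<dots> \<le> q ^ (n - 1)" using assms by (auto intro!: power_increasing)
  finally show ?thesis using assms(4) by (simp add: prod.remove mult.commute)
qed

section \<open>Chains of primes of exponent one\<close>

text \<open>A pair leads from \<open>w\<close> to a prime \<open>v\<close> dividing its divisor sum
  \<open>w + 1\<close>, so chains that start at the largest prime \<open>q\<close> descend.\<close>

definition R :: "(nat \<times> nat) set" where
  "R = {(w, v). w \<in> Q \<and> v \<in> Q \<and> v dvd w + 1}"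

text \<open>A prime of \<open>Q\<close> whose divisor sum is divisible by \<open>q\<close> would
  exceed \<open>q\<close>.\<close>

lemma Max_Q_dvd:
  assumes "q \<in> Q" "\<And>x. x \<in> Q \<Longrightarrow> x \<le> q"
  shows "\<exists>p\<in>W. q dvd g p"
proof -
  obtain l where l: "l \<in> V" "q dvd g l" using ex_dvd_g[of q] assms(1) by (auto simp: Q_def)
  have "l \<notin> Q"
  proof
    assume "l \<in> Q"
    then have "q < l" using dvd_succ_Q(2)[of q l] l assms(1) by (simp add: g_Q Q_def)
    then show False using assms(2)[OF \<open>l \<in> Q\<close>] by simp
  qed
  then show ?thesis using l by (auto simp: W_def)
qed

lemma spare_factor:
  assumes "p \<in> W" "A \<subseteq> W - {p}" "card A + 2 \<le> card W"
  shows "\<exists>z\<in>W - {p}. z \<notin> A"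
proof (rule ccontr)
  assume "\<not> ?thesis"
  then have "W - {p} \<subseteq> A" by blast
  then have "card (W - {p}) \<le> card A" using assms(2) by (meson card_mono fin_W finite_Diff finite_subset)
  then show False using assms by simp
qed

text \<open>Some prime of \<open>W\<close> remains outside \<open>A\<close> and \<open>p\<close>;
  its power is at least 9 and serves to absorb constants.\<close>

lemma prod_f_spare:
  assumes "p \<in> W" "A \<subseteq> W - {p}" "card A + 2 \<le> card W"
  shows "9 * prod f A \<le> prod f (W - {p})"
proof -
  obtain z where z: "z \<in> W - {p}" "z \<notin> A" using spare_factor[OF assms] by blast
  have "finite A" using assms(2) by (meson fin_W finite_Diff finite_subset)
  then have "9 * prod f A \<le> prod f (insert z A)" using z f_W9[of z] by simp
  also have "\<dots> \<le> prod f (W - {p})" using z assms(2) by (intro prod_f_sub) (auto simp: W_def)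
  finally show ?thesis .
qed

section \<open>The case where \<open>p\<close> has exponent two\<close>

context
  fixes p q :: nat
  assumes p_W: "p \<in> W" and e2: "e p = 2"
    and q_Q: "q \<in> Q" and q_max: "\<And>x. x \<in> Q \<Longrightarrow> x \<le> q" and q_dvd: "q dvd g p"
begin

lemma p_V: "p \<in> V" and q_V: "q \<in> V"
  using p_W q_Q by (auto simp: W_def Q_def)

lemma p_ge3: "3 \<le> p" using V_ge3[OF p_V] .

lemma g_p: "g p = p * p + p + 1"
  by (simp add: g_def e2 numeral_2_eq_2)

lemma q_le: "q \<le> p * p + p + 1"
  using q_dvd g_p by (simp add: dvd_imp_le)

text \<open>For \<open>p \<ge> 3\<close> the number \<open>p * p + p + 1\<close> is at most 13/9 of
  \<open>p ^ 2\<close>, and (13/9)^3 < 4.\<close>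

lemma q_cube: "q ^ 3 \<le> 4 * p ^ 6"
proof -
  have "3 * p \<le> p * p" using p_ge3 by simp
  moreover have "9 \<le> p * p" using mult_le_mono[OF p_ge3 p_ge3] by simp
  ultimately have "9 * q \<le> 13 * (p * p)" using q_le by linarith
  then have "(9 * q) ^ 3 \<le> (13 * p ^ 2) ^ 3" unfolding power2_eq_square by (rule power_mono) simp
  then have "729 * q ^ 3 \<le> 2197 * p ^ 6"
    by (simp add: power_mult_distrib flip: power_mult)
  then show ?thesis by simp
qed

text \<open>Unwinding a chain \<open>q = w\<^sub>0, w\<^sub>1, \<dots>\<close> with \<open>w\<^sub>i + 1 = c\<^sub>i * w\<^sub>i\<^sub>+\<^sub>1\<close> expresses \<open>p\<^sup>2 + p + 1\<close> through
  its last member; the correction \<open>F\<close> stays below the coefficient because every \<open>c\<^sub>i\<close> is at least 2.\<close>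

lemma chain_invariant:
  assumes "(q, s) \<in> R\<^sup>*"
  shows "s \<in> Q \<and> (\<exists>E F. E * s = p * p + p + 1 + F \<and> F < E)"
  using assms
proof (induction rule: rtrancl_induct)
  case base
  obtain u where "g p = q * u" using q_dvd by blast
  then have "u * q = p * p + p + 1 + 0 \<and> 0 < u" using g_p by (cases u) (auto simp: mult.commute)
  then show ?case using q_Q by blast
next
  case (step w v)
  then obtain E F where EF: "w \<in> Q" "E * w = p * p + p + 1 + F" "F < E" by blast
  have v: "v \<in> Q" "v dvd w + 1" using step.hyps by (auto simp: R_def)
  then obtain c where c: "w + 1 = v * c" by blast
  have "2 * v \<le> w + 1" using dvd_succ_Q(1)[of v w] v EF by (auto simp: Q_def)
  then have "2 \<le> c" using c V_ge3[of v] v by (auto simp: Q_def mult.commute)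
  then have "E * 2 \<le> E * c" by simp
  then have "F + E < E * c" using EF by linarith
  moreover have "E * c * v = p * p + p + 1 + (F + E)"
    using EF c by (metis (no_types, lifting) add.assoc distrib_left mult.assoc mult.commute mult.right_neutral)
  ultimately show ?case using v by blast
qed

lemma dvd_succ_ge:
  assumes "s \<in> Q" "p dvd s + 1"
  shows "2 * p \<le> s + 1"
  using dvd_succ_Q(1)[OF p_V assms] .

text \<open>Modulo \<open>p\<close> the chain identity shows that \<open>p\<close> divides
  \<open>1 + F + E\<close>, so \<open>F < E\<close> and parity give
  \<open>p + 1 \<le> 2 * E\<close>. With so large a coefficient \<open>E\<close>, the multiple
  \<open>s + 1\<close> of \<open>2 * p\<close> cannot reach \<open>4 * p\<close>.\<close>

lemma chain_end:
  assumes "(q, s) \<in> R\<^sup>*" "p dvd s + 1"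
  shows "s + 1 = 2 * p"
proof -
  obtain E F where EF: "s \<in> Q" "E * s = p * p + p + 1 + F" "F < E"
    using chain_invariant[OF assms(1)] by blast
  have *: "E * (s + 1) = p * p + p + (1 + F + E)" using EF by simp
  then have "p dvd p * p + p + (1 + F + E)" using assms(2) by (metis dvd_mult)
  then have "p dvd 1 + F + E" by (metis dvd_add_right_iff dvd_add dvd_triv_left dvd_refl)
  then have "p \<le> 1 + F + E" by (rule dvd_imp_le) simp
  then have "p \<le> 2 * E" using EF by linarith
  moreover have "p \<noteq> 2 * E" using odd_V[OF p_V] by auto
  ultimately have E: "p + 1 \<le> 2 * E" by linarith
  have "odd s" using EF odd_V by (simp add: Q_def)
  then have "2 * p dvd s + 1" using assms(2) odd_V[OF p_V] by (intro divides_mult) auto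
  then obtain j where j: "s + 1 = 2 * p * j" by blast
  have "j < 2"
  proof (rule ccontr)
    assume "\<not> j < 2"
    then have "2 * p * 2 \<le> s + 1" unfolding j by (intro mult_le_mono) auto
    then have "E * (4 * p) \<le> E * (s + 1)" by (intro mult_le_mono) auto
    then have "E * (4 * p) \<le> p * p + p + (1 + F + E)" unfolding * .
    then have "4 * (E * p) \<le> p * p + p + 2 * E" using EF(3) by simp
    moreover have "p * p + p \<le> 2 * (E * p)" using mult_le_mono1[OF E, of p] by simp
    moreover have "3 * E \<le> E * p" using p_ge3 by simp
    ultimately show False using E by linarith
  qed
  then show ?thesis using j by (cases j) (auto simp: less_Suc_eq numeral_2_eq_2)
qed

text \<open>The empty chain would give \<open>q = 2 * p - 1\<close>. Since 4(p^2 + p + 1) = 7 + (2p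
  - 1)(2p + 3), \<open>q\<close> would divide 7, forcing the even value
  \<open>p = 4\<close>.\<close>

lemma not_dvd_succ_q: "\<not> p dvd q + 1"
proof
  assume "p dvd q + 1"
  then have q: "q + 1 = 2 * p" using chain_end by blast
  then have "q dvd 7 + q * (2 * p + 3)"
  proof -
    have "4 * (p * p + p + 1) = 7 + (2 * p - 1) * (2 * p + 3)"
      using p_ge3 by (cases p) (auto simp: algebra_simps)
    moreover have "q = 2 * p - 1" using q by simp
    ultimately show ?thesis using q_dvd g_p by (metis dvd_mult)
  qed
  then have "q dvd 7" by (metis dvd_add_left_iff dvd_triv_left)
  moreover have "prime (7::nat)" by simp
  ultimately have "q = 1 \<or> q = 7" by (meson prime_nat_iff)
  then have "p = 4" using q p_ge3 by auto
  then show False using odd_V[OF p_V] by simp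
qed

text \<open>Climb from \<open>x\<close> to a prime whose divisor sum it divides. Inside
  \<open>Q\<close> this increases \<open>x\<close>, so the climb stops at \<open>q\<close> or at a
  prime with a source in \<open>W\<close> other than \<open>p\<close>.\<close>

lemma root_or_chain:
  assumes "x \<in> Q" "2 * p \<le> x + 1"
  shows "(q, x) \<in> R\<^sup>* \<or> (\<exists>y\<in>Q. y \<noteq> q \<and> x \<le> y \<and> (\<exists>l\<in>W - {p}. y dvd g l))"
  using assms
proof (induction "q - x" arbitrary: x rule: less_induct)
  case less
  show ?case
  proof (cases "x = q")
    case False
    obtain l where l: "l \<in> V" "x dvd g l" using ex_dvd_g less.prems by (auto simp: Q_def)
    consider "l \<in> Q" | "l = p" | "l \<in> W - {p}" using l QW_un by blast
    then show ?thesis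
    proof cases
      case 1
      then have d: "x dvd l + 1" using l g_Q by simp
      then have "x < l" using dvd_succ_Q(2)[of x l] 1 less.prems by (auto simp: Q_def)
      moreover have "l \<le> q" using q_max 1 .
      ultimately have "(q, l) \<in> R\<^sup>* \<or> (\<exists>y\<in>Q. y \<noteq> q \<and> l \<le> y \<and> (\<exists>l\<in>W - {p}. y dvd g l))"
        using less.prems by (intro less.hyps) (auto simp: 1)
      moreover have "(l, x) \<in> R" using 1 d less.prems by (simp add: R_def)
      ultimately show ?thesis using \<open>x < l\<close> by (meson less_imp_le le_trans rtrancl.rtrancl_into_rtrancl)
    next
      case 2
      \<comment> \<open>The source cannot be \<open>p\<close>: then \<open>x * q\<close> would
        divide \<open>p * p + p + 1\<close>, although both factors are at least
        \<open>2 * p - 1\<close>.\<close>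
      have "coprime x q" using False less.prems q_Q prime_V by (auto simp: Q_def intro: primes_coprime)
      then have "x * q dvd g p" using l 2 q_dvd divides_mult by blast
      then have "x * q \<le> p * p + p + 1" using g_p by (simp add: dvd_imp_le)
      moreover have "(2 * p - 1) * (2 * p - 1) \<le> x * q"
        using less.prems q_max[OF less.prems(1)] by (intro mult_le_mono) auto
      moreover obtain j where "p = 3 + j" using p_ge3 le_Suc_ex by blast
      ultimately have False by (simp add: algebra_simps)
      then show ?thesis ..
    next
      case 3
      then show ?thesis using l False less.prems by blast
    qed
  qed simp
qed

text \<open>Neither \<open>g p\<close> nor any \<open>s + 1\<close> with \<open>s\<close> in
  \<open>Q\<close> supplies a factor \<open>p\<close>, so the remaining divisor sums supply
  both.\<close>

lemma square_dvd_rest: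
  assumes "\<And>s. s \<in> Q \<Longrightarrow> \<not> p dvd s + 1"
  shows "p ^ 2 dvd prod g (W - {p})"
proof -
  have "p ^ 2 dvd prod g V" using dvd_prod_g[OF p_V] by (simp add: f_def e2)
  also have "prod g V = prod g (insert p Q) * prod g (W - {p})"
  proof -
    have "V = insert p Q \<union> (W - {p})" "insert p Q \<inter> (W - {p}) = {}"
      using p_W QW_un QW_disj by blast+
    then show ?thesis using prod.union_disjoint[of "insert p Q" "W - {p}" g] by simp
  qed
  finally have "p ^ 2 dvd prod g (insert p Q) * prod g (W - {p})" .
  moreover have "\<not> p dvd prod g (insert p Q)"
    using prime_dvd_prod_iff[of "insert p Q" p g] prime_V[OF p_V] not_dvd_g[OF p_V] assms g_Q
    by fastforce
  then have "coprime (p ^ 2) (prod g (insert p Q))"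
    using prime_V[OF p_V] by (simp add: prime_imp_coprime)
  ultimately show ?thesis using coprime_dvd_mult_right_iff by blast
qed

text \<open>The constant 4 comes from two different sources, each at least 2p/3, together with a
  spare factor 9. A single source gives even 6.\<close>

lemma square_dvd_rest_size:
  assumes "p ^ 2 dvd prod g (W - {p})" "4 \<le> card W"
  shows "4 * p ^ 2 \<le> prod f (W - {p})"
proof -
  obtain l where l: "l \<in> W - {p}" "p dvd g l"
    "p ^ 2 dvd g l \<or> (\<exists>l'\<in>W - {p}. l' \<noteq> l \<and> p dvd g l')"
    using prime_square_dvd_prod[OF prime_V[OF p_V] _ assms(1)] by auto
  have V: "l \<in> V" using l by (auto simp: W_def)
  from l(3) show ?thesis
  proof
    assume "p ^ 2 dvd g l"
    then have "2 * p ^ 2 \<le> 3 * f l" using dvd_g_le V by blast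
    moreover have "9 * f l \<le> prod f (W - {p})"
      using prod_f_spare[OF p_W, of "{l}"] l assms by simp
    ultimately show ?thesis by linarith
  next
    assume "\<exists>l'\<in>W - {p}. l' \<noteq> l \<and> p dvd g l'"
    then obtain l' where l': "l' \<in> W - {p}" "l' \<noteq> l" "p dvd g l'" by blast
    then have "(2 * p) * (2 * p) \<le> (3 * f l) * (3 * f l')"
      using l V by (intro mult_le_mono dvd_g_le) (auto simp: W_def)
    moreover have "9 * (f l * f l') \<le> prod f (W - {p})"
      using prod_f_spare[OF p_W, of "{l, l'}"] l l' assms by simp
    ultimately show ?thesis by (simp add: power2_eq_square)
  qed
qed

text \<open>The number \<open>y\<close> replaces one factor \<open>q\<close> in the bound for
  \<open>\<Prod>Q\<close>, and the rest of the powerful part is large enough to pay for it.\<close>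

lemma exists_balancing_factor:
  assumes "card Q \<le> n" "4 \<le> card W" "1 \<le> n"
  shows "\<exists>y. p \<le> y \<and> \<Prod>Q \<le> q ^ (n - 1) * y \<and> 2 * y \<le> prod f (W - {p})"
proof -
  have q0: "0 < q" using V_ge3[OF q_V] by simp
  \<comment> \<open>If no member of \<open>Q\<close> from \<open>p\<close> upwards has a source in
    \<open>W - {p}\<close>, every \<open>s\<close> with \<open>p dvd s + 1\<close> ends a chain from
    \<open>q\<close>; then \<open>s = 2 * p - 1\<close>, so it is unique.\<close>
  consider (none) "\<And>s. s \<in> Q \<Longrightarrow> \<not> p dvd s + 1"
    | (root) y l where "y \<in> Q" "p \<le> y" "l \<in> W - {p}" "y dvd g l"
    | (chain) s where "s \<in> Q" "(q, s) \<in> R\<^sup>*" "p dvd s + 1" "\<And>s'. s' \<in> Q \<Longrightarrow> p dvd s' + 1 \<Longrightarrow> s' = s"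
  proof (cases "\<exists>y\<in>Q. p \<le> y \<and> (\<exists>l\<in>W - {p}. y dvd g l)")
    case False
    have "(q, s) \<in> R\<^sup>*" if "s \<in> Q" "p dvd s + 1" for s
    proof -
      have "2 * p \<le> s + 1" using dvd_succ_ge[OF that] .
      then show ?thesis using root_or_chain[OF that(1)] False p_ge3
        by (meson le_trans dvd_succ_Q(2) p_V that less_imp_le)
    qed
    then show ?thesis using chain_end that by (metis add_right_cancel)
  qed (use that in blast)
  then show ?thesis
  proof cases
    \<comment> \<open>The witness is \<open>2 * p ^ 2\<close>, which bounds \<open>q\<close> and is
      half of the guaranteed size of the rest.\<close>
    case none
    have "\<Prod>Q \<le> q ^ (n - 1) * q" using prod_Q_le'[OF assms(1) q_max q0 q_Q] by simp
    also have "\<dots> \<le> q ^ (n - 1) * (2 * p ^ 2)"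
    proof (rule mult_le_mono2)
      have "3 * p \<le> p * p" using p_ge3 by simp
      then show "q \<le> 2 * p ^ 2" using q_le p_ge3 unfolding power2_eq_square by linarith
    qed
    finally show ?thesis
      using square_dvd_rest_size[OF square_dvd_rest[OF none] assms(2)] p_ge3
      by (intro exI[of _ "2 * p ^ 2"]) (auto simp: power2_eq_square)
  next
    case (root y l)
    have "2 * y \<le> 3 * f l" using root dvd_g_le by (auto simp: W_def)
    moreover have "9 * f l \<le> prod f (W - {p})"
      using prod_f_spare[OF p_W, of "{l}"] root assms by simp
    ultimately show ?thesis
      using prod_Q_le'[OF assms(1) q_max q0 root(1)] root by (intro exI[of _ y]) auto
  next
    case (chain s)
    have s: "s + 1 = 2 * p" using chain_end chain by blast
    \<comment> \<open>Within \<open>Q\<close> only \<open>s\<close> supplies \<open>p\<close>, and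
      \<open>s + 1 = 2 * p\<close> supplies it once; the second factor must come from the
      rest.\<close>
    have "p dvd prod g (W - {p})"
    proof (rule ccontr)
      assume not: "\<not> ?thesis"
      have "\<not> p dvd prod g (insert p (Q - {s}) \<union> (W - {p}))"
      proof
        assume "p dvd prod g (insert p (Q - {s}) \<union> (W - {p}))"
        then obtain l where l: "l \<in> insert p (Q - {s}) \<union> (W - {p})" "p dvd g l"
          using prime_dvd_prod_iff[of "insert p (Q - {s}) \<union> (W - {p})" p g] prime_V[OF p_V] by auto
        moreover have "\<not> (l \<in> W - {p})"
          using not l(2) by (meson dvd_prodI dvd_trans fin_W finite_Diff)
        ultimately show False using not_dvd_g[OF p_V] chain(4) g_Q by auto
      qed
      moreover have "prod g V = g s * prod g (insert p (Q - {s}) \<union> (W - {p}))"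
      proof -
        have "V - {s} = insert p (Q - {s}) \<union> (W - {p})" "s \<in> V"
          using p_W QW_un QW_disj chain(1) by blast+
        then show ?thesis using prod.remove[OF fin, of s g] by simp
      qed
      moreover have "p ^ 2 dvd prod g V" using dvd_prod_g[OF p_V] by (simp add: f_def e2)
      ultimately have "p ^ 2 dvd g s"
        using prime_V[OF p_V] by (metis coprime_dvd_mult_left_iff coprime_power_left_iff prime_imp_coprime)
      then have "p * p dvd 2 * p" using g_Q[OF chain(1)] s by (simp add: power2_eq_square)
      then have "p * p \<le> 2 * p" using p_ge3 by (intro dvd_imp_le) auto
      then show False using p_ge3 by simp
    qed
    then obtain l where l: "l \<in> W - {p}" "p dvd g l"
      using prime_dvd_prod_iff[of "W - {p}"] prime_V[OF p_V] by auto
    have "2 * p \<le> 3 * f l" using l dvd_g_le by (auto simp: W_def)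
    moreover have "9 * f l \<le> prod f (W - {p})"
      using prod_f_spare[OF p_W, of "{l}"] l assms by simp
    ultimately show ?thesis
      using prod_Q_le'[OF assms(1) q_max q0 chain(1)] s p_ge3 by (intro exI[of _ s]) auto
  qed
qed

end

end

section \<open>Radical bounds\<close>

text \<open>Here \<open>A\<close> is the product of \<open>Q\<close>, \<open>F\<close> the power of
  \<open>p\<close>, and \<open>s\<close>, \<open>r\<close> are the radical and size of the rest.
  Cancelling powers of \<open>A\<close> and paying for \<open>s\<close> with
  \<open>r ^ (2 * n + 2)\<close> leaves \<open>r ^ (2 * n - 1)\<close>.\<close>

lemma combine_powers_general:
  fixes A p F r s n :: nat
  assumes "s ^ 2 \<le> r" "0 < A" "0 < r" "A ^ 3 * p ^ (4 * n + 4) < F ^ (4 * n + 1) * r ^ (2 * n - 1)" "1 \<le> n"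
  shows "(A * p * s) ^ (4 * n + 4) < (A * F * r) ^ (4 * n + 1)"
proof -
  have "s ^ (4 * n + 4) = (s ^ 2) ^ (2 * n + 2)" by (simp add: power_add power_mult)
  also have "\<dots> \<le> r ^ (2 * n + 2)" using assms(1) by (rule power_mono) simp
  finally have s: "s ^ (4 * n + 4) \<le> r ^ (2 * n + 2)" .
  have "(A * p * s) ^ (4 * n + 4) = A ^ (4 * n + 1) * (A ^ 3 * p ^ (4 * n + 4)) * s ^ (4 * n + 4)"
    by (simp add: power_mult_distrib power_add power3_eq_cube power4_eq_xxxx)
  also have "\<dots> \<le> A ^ (4 * n + 1) * (A ^ 3 * p ^ (4 * n + 4)) * r ^ (2 * n + 2)"
    using s by (rule mult_le_mono2)
  also have "\<dots> < A ^ (4 * n + 1) * (F ^ (4 * n + 1) * r ^ (2 * n - 1)) * r ^ (2 * n + 2)"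
    using assms by simp
  also have "\<dots> = A ^ (4 * n + 1) * F ^ (4 * n + 1) * r ^ ((2 * n - 1) + (2 * n + 2))"
    by (simp only: power_add mult.assoc)
  also have "(2 * n - 1) + (2 * n + 2) = 4 * n + 1" using assms(5) by simp
  finally show ?thesis by (simp only: power_mult_distrib)
qed

text \<open>The bounds q^3 \<le> 4 F^3 and p^4 \<le> F use up exactly F^(4n+1); the remaining 4^n is
  covered by \<open>r \<ge> 9\<close>.\<close>

lemma power_bound_exponent_ge4:
  fixes A p q r a n :: nat
  assumes "2 * q \<le> 3 * p ^ a" "9 \<le> r" "A \<le> q ^ n" "4 \<le> a" "1 \<le> n" "0 < p"
  shows "A ^ 3 * p ^ (4 * n + 4) < (p ^ a) ^ (4 * n + 1) * r ^ (2 * n - 1)"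
proof -
  define F where "F = p ^ a"
  have F0: "0 < F" using assms by (simp add: F_def)
  have "(2 * q) ^ 3 \<le> (3 * F) ^ 3" using assms(1) unfolding F_def by (rule power_mono) simp
  then have q: "q ^ 3 \<le> 4 * F ^ 3" by (simp add: power_mult_distrib)
  have "A ^ 3 \<le> (q ^ n) ^ 3" using assms(3) by (rule power_mono) simp
  also have "\<dots> = (q ^ 3) ^ n" by (simp add: mult.commute flip: power_mult)
  also have "\<dots> \<le> (4 * F ^ 3) ^ n" using q by (rule power_mono) simp
  finally have A: "A ^ 3 \<le> 4 ^ n * F ^ (3 * n)" by (simp add: power_mult_distrib flip: power_mult)
  have "p ^ (4 * n + 4) = (p ^ 4) ^ (n + 1)" by (simp add: power_add power_mult)
  also have "\<dots> \<le> F ^ (n + 1)"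
    unfolding F_def using assms by (intro power_mono power_increasing) auto
  finally have p: "p ^ (4 * n + 4) \<le> F ^ (n + 1)" .
  have "A ^ 3 * p ^ (4 * n + 4) \<le> (4 ^ n * F ^ (3 * n)) * F ^ (n + 1)"
    using A p by (rule mult_le_mono)
  also have "\<dots> = 4 ^ n * F ^ (4 * n + 1)" by (simp add: mult.assoc flip: power_add)
  also have "\<dots> < 9 ^ (2 * n - 1) * F ^ (4 * n + 1)"
  proof -
    have "(4::nat) ^ n < 9 ^ n" using assms by (intro power_strict_mono) auto
    also have "\<dots> \<le> 9 ^ (2 * n - 1)" using assms by (intro power_increasing) auto
    finally show ?thesis using F0 by simp
  qed
  also have "\<dots> \<le> r ^ (2 * n - 1) * F ^ (4 * n + 1)"
    using assms(2) by (intro mult_le_mono1 power_mono) auto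
  finally show ?thesis by (simp add: F_def mult.commute)
qed

lemma power_bound_exponent_3:
  fixes A p q r n :: nat
  assumes "q \<le> p ^ 2" "9 \<le> r" "A \<le> q ^ n" "1 \<le> n" "0 < p"
  shows "A ^ 3 * p ^ (4 * n + 4) < (p ^ 3) ^ (4 * n + 1) * r ^ (2 * n - 1)"
proof -
  have "A \<le> (p ^ 2) ^ n" using assms(1,3) by (meson le_trans power_mono zero_le)
  then have "A ^ 3 \<le> ((p ^ 2) ^ n) ^ 3" by (rule power_mono) simp
  then have "A ^ 3 * p ^ (4 * n + 4) \<le> ((p ^ 2) ^ n) ^ 3 * p ^ (4 * n + 4)" by (rule mult_le_mono1)
  also have "\<dots> = p ^ (10 * n + 4)" by (simp flip: power_mult power_add)
  also have "\<dots> \<le> p ^ (3 * (4 * n + 1))" using assms by (intro power_increasing) auto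
  also have "\<dots> < p ^ (3 * (4 * n + 1)) * r ^ (2 * n - 1)"
    using assms one_less_power[of r "2 * n - 1"] by simp
  finally show ?thesis by (simp only: power_mult)
qed

text \<open>After p^(8n+2) is matched, a surplus p^(2n-4) remains and is bounded by the same power
  of \<open>y\<close>. With the y^3 at hand this gives y^(2n-1), which \<open>r\<close>
  covers.\<close>

lemma power_bound_exponent_2:
  fixes A p q r y n :: nat
  assumes "q ^ 3 \<le> 4 * p ^ 6" "A \<le> q ^ (n - 1) * y" "p \<le> y" "2 * y \<le> r" "2 \<le> n" "0 < p"
  shows "A ^ 3 * p ^ (4 * n + 4) < (p ^ 2) ^ (4 * n + 1) * r ^ (2 * n - 1)"
proof -
  obtain j where n: "n = j + 2" using assms(5) by (metis add.commute le_Suc_ex)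
  have "A ^ 3 \<le> (q ^ (j + 1) * y) ^ 3" using assms(2) unfolding n by (intro power_mono) auto
  also have "\<dots> = (q ^ 3) ^ (j + 1) * y ^ 3"
    by (simp only: power_mult_distrib mult.commute flip: power_mult)
  also have "\<dots> \<le> (4 * p ^ 6) ^ (j + 1) * y ^ 3"
    using assms(1) by (intro mult_le_mono1 power_mono) auto
  also have "\<dots> = 4 ^ (j + 1) * p ^ (6 * (j + 1)) * y ^ 3"
    by (simp only: power_mult_distrib power_mult)
  finally have A: "A ^ 3 \<le> 4 ^ (j + 1) * p ^ (6 * (j + 1)) * y ^ 3" .
  have y0: "0 < y" using assms by simp
  have "A ^ 3 * p ^ (4 * n + 4) \<le> 4 ^ (j + 1) * p ^ (6 * (j + 1)) * y ^ 3 * p ^ (4 * n + 4)"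
    using A by (rule mult_le_mono1)
  also have "\<dots> = 4 ^ (j + 1) * y ^ 3 * p ^ (8 * j + 18) * p ^ (2 * j)"
  proof -
    have "p ^ (6 * (j + 1)) * p ^ (4 * n + 4) = p ^ (8 * j + 18) * p ^ (2 * j)"
      by (simp add: n add.commute flip: power_add)
    moreover have "4 ^ (j + 1) * p ^ (6 * (j + 1)) * y ^ 3 * p ^ (4 * n + 4)
        = 4 ^ (j + 1) * y ^ 3 * (p ^ (6 * (j + 1)) * p ^ (4 * n + 4))"
      by (simp only: mult_ac)
    ultimately show ?thesis by (simp only: mult.assoc)
  qed
  also have "\<dots> \<le> 4 ^ (j + 1) * y ^ 3 * p ^ (8 * j + 18) * y ^ (2 * j)"
    using assms(3) by (intro mult_le_mono2 power_mono) auto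
  \<comment> \<open>Doubling completes \<open>4 ^ (j + 1)\<close> to \<open>2 ^ (2 * j + 3)\<close>
    and makes the bound strict.\<close>
  also have "\<dots> < 2 * \<dots>" using y0 assms(6) by simp
  also have "\<dots> = p ^ (8 * j + 18) * (2 * y) ^ (2 * j + 3)"
  proof -
    have "(2::nat) ^ (2 * j + 3) = 2 * 4 ^ (j + 1)" by (simp add: power_add power_mult)
    then show ?thesis by (simp add: power_mult_distrib power_add)
  qed
  also have "\<dots> \<le> p ^ (8 * j + 18) * r ^ (2 * j + 3)"
    using assms(4) by (intro mult_le_mono2 power_mono) auto
  also have "\<dots> = (p ^ 2) ^ (4 * n + 1) * r ^ (2 * n - 1)"
  proof -
    have "8 * j + 18 = 2 * (4 * n + 1)" "2 * j + 3 = 2 * n - 1" using n by simp_all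
    then show ?thesis by (simp only: power_mult)
  qed
  finally show ?thesis .
qed

text \<open>The factor \<open>s\<close> stays in the hypothesis because one case below needs more
  than \<open>s ^ 2 \<le> r\<close>.\<close>

lemma combine_powers_14_9:
  fixes q p F r s :: nat
  assumes "0 < q" "q ^ 5 * p ^ 14 * s ^ 14 < F ^ 9 * r ^ 9"
  shows "(q * p * s) ^ 14 < (q * F * r) ^ 9"
proof -
  have "(q * p * s) ^ 14 = q ^ 9 * (q ^ 5 * p ^ 14 * s ^ 14)"
    by (simp add: power_mult_distrib mult.assoc flip: power_add)
  also have "\<dots> < q ^ 9 * (F ^ 9 * r ^ 9)" using assms by simp
  finally show ?thesis by (simp add: power_mult_distrib mult.assoc)
qed

lemma square_bound_14_9:
  fixes q p F r s :: nat
  assumes "s ^ 2 \<le> r" "0 < r" "q ^ 5 * p ^ 14 < F ^ 9 * r ^ 2"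
  shows "q ^ 5 * p ^ 14 * s ^ 14 < F ^ 9 * r ^ 9"
proof -
  have "s ^ 14 = (s ^ 2) ^ 7" by (simp flip: power_mult)
  also have "\<dots> \<le> r ^ 7" using assms(1) by (rule power_mono) simp
  finally have "q ^ 5 * p ^ 14 * s ^ 14 \<le> q ^ 5 * p ^ 14 * r ^ 7" by (rule mult_le_mono2)
  also have "\<dots> < F ^ 9 * r ^ 2 * r ^ 7" using assms by simp
  finally show ?thesis by (simp add: mult.assoc flip: power_add)
qed

section \<open>The bound for \<open>k\<close> divisible by 4\<close>

context odd_multiperfect
begin

lemma prod_split:
  assumes "p \<in> W"
  shows "prod h V = prod h Q * h p * prod h (W - {p})"
proof -
  have "prod h V = prod h Q * prod h W"
    using prod.union_disjoint[of Q W h] QW_disj QW_un by simp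
  then show ?thesis using prod.remove[OF fin_W assms, of h] by (simp add: mult.assoc)
qed

lemma prod_f_Q: "prod f Q = \<Prod>Q"
  by (intro prod.cong) (auto simp: f_def Q_def)

lemma rest_bounds:
  assumes "p \<in> W" "2 \<le> card W"
  shows "\<Prod>(W - {p}) ^ 2 \<le> prod f (W - {p})" "9 \<le> prod f (W - {p})"
  using sq_prod_le[of "W - {p}"] prod_f_spare[of p "{}"] assms by auto

lemma square_le_if_no_simple:
  assumes "Q = {}"
  shows "\<Prod>V ^ 2 \<le> prod f V"
  using sq_prod_le[of V] assms by (simp add: W_def)

text \<open>The divisor sum factors as \<open>(p + 1) * (p ^ 2 + 1)\<close>, and parity excludes
  \<open>q = p ^ 2 + 1\<close>.\<close>

lemma dvd_g_exponent_3:
  assumes "q \<in> Q" "p \<in> W" "q dvd g p" "e p = 3"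
  shows "q \<le> p ^ 2"
proof -
  have p3: "3 \<le> p" using assms V_ge3 by (simp add: W_def)
  have "g p = (p + 1) * (p ^ 2 + 1)"
    by (simp add: g_def assms(4) numeral_eq_Suc algebra_simps)
  then have "q dvd p + 1 \<or> q dvd p ^ 2 + 1"
    using assms prime_V by (metis (no_types, lifting) Q_def mem_Collect_eq prime_dvd_mult_iff)
  then show ?thesis
  proof
    assume "q dvd p + 1"
    then have "q \<le> p + 1" by (rule dvd_imp_le) simp
    moreover have "3 * p \<le> p ^ 2" using p3 by (simp add: power2_eq_square)
    ultimately show ?thesis using p3 by linarith
  next
    assume *: "q dvd p ^ 2 + 1"
    have "q \<noteq> p ^ 2 + 1" using odd_V[of q] odd_V[of p] assms by (auto simp: W_def Q_def)
    moreover have "q \<le> p ^ 2 + 1" using * by (rule dvd_imp_le) simp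
    ultimately show ?thesis by simp
  qed
qed

theorem radical_bound_general:
  assumes "k = 2 ^ n * t" "odd t" "2 \<le> n"
  shows "\<Prod>V ^ (4 * n + 4) < prod f V ^ (4 * n + 1)"
proof -
  have "2 ^ n \<le> k" using assms by (cases t) auto
  then have cV: "n + 4 \<le> card V" using card_V_ge assms by blast
  have cQ: "card Q \<le> n" using card_Q_le assms by blast
  have "card V = card Q + card W" using QW_un QW_disj by (metis card_Un_disjoint fin_Q fin_W)
  then have cW: "4 \<le> card W" using cV cQ by linarith
  show ?thesis
  proof (cases "Q = {}")
    case True
    obtain p where p: "p \<in> W" using cW by fastforce
    have "9 \<le> prod f {p}" using f_W9[OF p] by simp
    also have "\<dots> \<le> prod f V" using p by (intro prod_f_sub) (auto simp: W_def)
    finally have f9: "9 \<le> prod f V" .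
    \<comment> \<open>All of \<open>m\<close> is powerful here, and
      \<open>2 * n + 2 < 4 * n + 1\<close>.\<close>
    have "\<Prod>V ^ (4 * n + 4) = (\<Prod>V ^ 2) ^ (2 * n + 2)" by (simp add: power_add power_mult)
    also have "\<dots> \<le> prod f V ^ (2 * n + 2)"
      using square_le_if_no_simple[OF True] by (rule power_mono) simp
    also have "\<dots> < prod f V ^ (4 * n + 1)"
      using f9 assms by (intro power_strict_increasing) auto
    finally show ?thesis .
  next
    case False
    define q where "q = Max Q"
    have q: "q \<in> Q" "\<And>x. x \<in> Q \<Longrightarrow> x \<le> q" using False by (auto simp: q_def)
    then obtain p where p: "p \<in> W" "q dvd g p" using Max_Q_dvd by blast
    have p3: "3 \<le> p" and q3: "3 \<le> q" using p q V_ge3 by (auto simp: W_def Q_def)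
    have A0: "0 < \<Prod>Q" using V_ge3 by (fastforce simp: Q_def intro: prod_pos)
    have Aq: "\<Prod>Q \<le> q ^ n" using prod_Q_le[OF cQ q(2)] q3 by simp
    define r where "r = prod f (W - {p})"
    have r: "\<Prod>(W - {p}) ^ 2 \<le> r" "9 \<le> r" using rest_bounds[OF p(1)] cW by (auto simp: r_def)
    have "\<Prod>Q ^ 3 * p ^ (4 * n + 4) < f p ^ (4 * n + 1) * r ^ (2 * n - 1)"
    proof -
      consider "e p = 2" | "e p = 3" | "4 \<le> e p" using e_W[OF p(1)] by linarith
      then show ?thesis
      proof cases
        case 1
        obtain y where y: "p \<le> y" "\<Prod>Q \<le> q ^ (n - 1) * y" "2 * y \<le> r"
          using exists_balancing_factor[OF p(1) 1 q p(2) cQ cW] assms unfolding r_def by auto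
        then show ?thesis
          using power_bound_exponent_2[OF q_cube[OF p(1) 1 q p(2)], of "\<Prod>Q" n y r] assms p3
          by (simp add: f_def 1)
      next
        case 2
        then show ?thesis
          using power_bound_exponent_3[OF dvd_g_exponent_3[OF q(1) p] r(2) Aq] assms p3
          by (simp add: f_def)
      next
        case 3
        have "2 * q \<le> 3 * p ^ e p" using dvd_g_le[of p q] p by (simp add: W_def f_def)
        then show ?thesis
          using power_bound_exponent_ge4[OF _ r(2) Aq 3, of p] assms p3 by (simp add: f_def)
      qed
    qed
    then have "(\<Prod>Q * p * \<Prod>(W - {p})) ^ (4 * n + 4) < (\<Prod>Q * f p * r) ^ (4 * n + 1)"
      using r A0 assms by (intro combine_powers_general) auto
    then show ?thesis
      using prod_split[OF p(1), of "\<lambda>x. x"] prod_split[OF p(1), of f]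
      by (simp add: prod_f_Q r_def)
  qed
qed

section \<open>The bound for \<open>k\<close> congruent to 2 modulo 4\<close>

lemma prod_f_spare2:
  assumes "p \<in> W" "A \<subseteq> W - {p}" "card A + 3 \<le> card W"
  shows "81 * prod f A \<le> prod f (W - {p})"
proof -
  obtain z where z: "z \<in> W - {p}" "z \<notin> A" using spare_factor[OF assms(1,2)] assms by auto
  have "finite A" using assms(2) by (meson fin_W finite_Diff finite_subset)
  then have "9 * (f z * prod f A) \<le> prod f (W - {p})"
    using prod_f_spare[OF assms(1), of "insert z A"] z assms by simp
  moreover have "9 * prod f A \<le> f z * prod f A" using f_W9[of z] z by simp
  ultimately show ?thesis by linarith
qed

text \<open>Both primes are roots of x^2 + x + 1 modulo \<open>p\<close>, so \<open>p\<close>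
  divides (l - l')(l + l' + 1) and \<open>p \<le> 2 * l\<close>. Thus \<open>f l\<close> is of order
  p^2.\<close>

lemma two_square_roots_size:
  assumes "p \<in> W" "l \<in> W - {p}" "l' \<in> W - {p}" "l' < l" "e l = 2" "e l' = 2"
    "p dvd g l" "p dvd g l'" "5 \<le> card W"
  shows "3 * p ^ 3 \<le> prod f (W - {p})"
proof -
  have g: "g l = l * l + l + 1" "g l' = l' * l' + l' + 1"
    by (simp_all add: g_def assms numeral_2_eq_2)
  have pp: "prime p" using assms prime_V by (simp add: W_def)
  obtain j where j: "l = l' + j" using assms(4) less_imp_add_positive by blast
  have "g l = g l' + j * (l + l' + 1)" unfolding g by (simp add: j algebra_simps)
  then have "p dvd j * (l + l' + 1)" using assms(7,8) dvd_add_right_iff by metis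
  then have "p dvd j \<or> p dvd l + l' + 1" using pp prime_dvd_mult_iff by blast
  then have "p \<le> j \<or> p \<le> l + l' + 1" using j assms(4) by (auto dest: dvd_imp_le)
  then have "p \<le> 2 * l" using j assms(4) by linarith
  then have "p * p \<le> (2 * l) * (2 * l)" by (intro mult_le_mono)
  then have "p * p \<le> 4 * f l" by (simp add: f_def assms power2_eq_square)
  moreover have "2 * p \<le> 3 * f l'" using dvd_g_le assms by (auto simp: W_def)
  ultimately have "(p * p) * (2 * p) \<le> (4 * f l) * (3 * f l')" by (rule mult_le_mono)
  moreover have "81 * (f l * f l') \<le> prod f (W - {p})"
    using prod_f_spare2[OF assms(1), of "{l, l'}"] assms by simp
  ultimately show ?thesis by (simp add: power3_eq_cube)
qed

text \<open>Exponent at least 3 gives l^14 \<le> L^5, where a mere square would need L^7. This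
  leaves L^4 r^2 to exceed \<open>7 * p ^ 6\<close>.\<close>

lemma high_exponent_size:
  assumes "p \<in> W" "l \<in> W - {p}" "3 \<le> e l" "p dvd g l"
    "p ^ 2 dvd g l \<or> (\<exists>l'\<in>W - {p}. l' \<noteq> l \<and> p dvd g l')" "5 \<le> card W"
  shows "7 * p ^ 6 * \<Prod>(W - {p}) ^ 14 < prod f (W - {p}) ^ 9"
proof -
  define r where "r = prod f (W - {p} - {l})"
  define s where "s = \<Prod>(W - {p} - {l})"
  define L where "L = f l"
  have lV: "l \<in> V" using assms by (simp add: W_def)
  have p3: "3 \<le> p" using assms V_ge3 by (simp add: W_def)
  have L0: "0 < L" using f_pos[OF lV] by (simp add: L_def)
  have split: "\<Prod>(W - {p}) = l * s" "prod f (W - {p}) = L * r"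
    using assms(2) by (simp_all add: r_def s_def L_def prod.remove)
  have "s ^ 2 \<le> r" unfolding s_def r_def by (rule sq_prod_le) auto
  then have "(s ^ 2) ^ 7 \<le> r ^ 7" by (rule power_mono) simp
  then have s: "s ^ 14 \<le> r ^ 7" by (simp flip: power_mult)
  have "l ^ 14 \<le> l ^ (e l * 5)" using assms(3) V_ge3[OF lV] by (intro power_increasing) auto
  then have l: "l ^ 14 \<le> L ^ 5" by (simp add: L_def f_def power_mult)
  have r9: "9 \<le> r"
    using prod_f_spare[OF assms(1), of "{l}"] assms L0 by (simp add: split flip: L_def)
  have main: "7 * p ^ 6 < L ^ 4 * r ^ 2"
    using assms(5)
  proof
    assume "p ^ 2 dvd g l"
    then have "2 * p ^ 2 \<le> 3 * L" using dvd_g_le lV L_def by blast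
    then have "(2 * p ^ 2) ^ 4 \<le> (3 * L) ^ 4" by (rule power_mono) simp
    then have "16 * p ^ 8 \<le> 81 * L ^ 4" by (simp add: power_mult_distrib flip: power_mult)
    moreover have "9 ^ 2 \<le> r ^ 2" using r9 by (rule power_mono) simp
    then have "81 * L ^ 4 \<le> L ^ 4 * r ^ 2" by simp
    moreover have "p ^ 6 \<le> p ^ 8" using p3 by (intro power_increasing) auto
    moreover have "0 < p ^ 6" using p3 by simp
    ultimately show ?thesis by linarith
  next
    assume "\<exists>l'\<in>W - {p}. l' \<noteq> l \<and> p dvd g l'"
    then obtain l' where l': "l' \<in> W - {p}" "l' \<noteq> l" "p dvd g l'" by blast
    have "2 * p \<le> 3 * L" using assms(4) dvd_g_le lV L_def by blast
    then have "(2 * p) ^ 4 \<le> (3 * L) ^ 4" by (rule power_mono) simp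
    then have "16 * p ^ 4 \<le> 81 * L ^ 4" by (simp add: power_mult_distrib)
    moreover have "2 * p \<le> 3 * f l'" using l' dvd_g_le by (simp add: W_def)
    moreover have "L * (9 * f l') \<le> L * r"
      using prod_f_spare[OF assms(1), of "{l, l'}"] assms l'
      by (simp add: split mult.left_commute flip: L_def)
    then have "9 * f l' \<le> r" using L0 by simp
    ultimately have "6 * p \<le> r" by linarith
    then have "(6 * p) ^ 2 \<le> r ^ 2" by (rule power_mono) simp
    then have "36 * p ^ 2 \<le> r ^ 2" by (simp add: power_mult_distrib)
    then have "(16 * p ^ 4) * (36 * p ^ 2) \<le> (81 * L ^ 4) * r ^ 2"
      by (rule mult_le_mono[OF \<open>16 * p ^ 4 \<le> 81 * L ^ 4\<close>])
    \<comment> \<open>The constant 7 just fits: 64/9 exceeds it only slightly.\<close>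
    then have "64 * p ^ 6 \<le> 9 * (r ^ 2 * L ^ 4)" by (simp flip: power_add)
    moreover have "0 < p ^ 6" using p3 by simp
    ultimately have "7 * p ^ 6 < r ^ 2 * L ^ 4" by linarith
    then show ?thesis by (simp only: mult.commute)
  qed
  have "7 * p ^ 6 * (l * s) ^ 14 = 7 * p ^ 6 * (l ^ 14 * s ^ 14)" by (simp only: power_mult_distrib)
  also have "\<dots> \<le> 7 * p ^ 6 * (L ^ 5 * r ^ 7)" using l s by (intro mult_le_mono2 mult_le_mono)
  also have "\<dots> < L ^ 4 * r ^ 2 * (L ^ 5 * r ^ 7)" using main L0 r9 by simp
  also have "\<dots> = (L ^ 4 * L ^ 5) * (r ^ 2 * r ^ 7)" by (simp only: mult_ac)
  also have "\<dots> = (L * r) ^ 9" by (simp add: power_mult_distrib flip: power_add)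
  finally show ?thesis by (simp add: split)
qed

text \<open>First \<open>p \<le> l\<close>. The factors \<open>l ^ 2\<close> of k m cannot all come
  from \<open>q + 1\<close> and \<open>g p\<close>, so \<open>l\<close> divides a further
  \<open>g l'\<close>; then \<open>f l * f l'\<close> is of order l^3.\<close>

lemma square_root_size:
  assumes "p \<in> W" "e p = 2" "Q = {q}" "q dvd g p" "l \<in> W - {p}" "e l = 2" "p ^ 2 dvd g l" "5 \<le> card W"
  shows "3 * p ^ 3 \<le> prod f (W - {p})"
proof -
  have V: "p \<in> V" "l \<in> V" "q \<in> V" "q \<in> Q" using assms by (auto simp: W_def Q_def)
  have p3: "3 \<le> p" and q3: "3 \<le> q" using V V_ge3 by auto
  have gp: "g p = p * p + p + 1" and gl: "g l = l * l + l + 1"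
    by (simp_all add: g_def assms numeral_2_eq_2)
  have pl: "p \<le> l"
  proof (rule ccontr)
    assume "\<not> p \<le> l"
    then have "(l + 1) * (l + 1) \<le> p * p" by (intro mult_le_mono) auto
    moreover have "p * p \<le> l * l + l + 1"
      using assms(7) g_pos[OF V(2)] by (metis dvd_imp_le gl power2_eq_square)
    moreover have "0 < l" using V_ge3[OF V(2)] by simp
    ultimately show False by simp
  qed
  have "l dvd prod g (W - {p})"
  proof (rule ccontr)
    assume "\<not> ?thesis"
    then have "coprime (l ^ 2) (prod g (W - {p}))"
      using prime_V[OF V(2)] by (simp add: prime_imp_coprime)
    moreover have "l ^ 2 dvd prod g Q * g p * prod g (W - {p})"
      using dvd_prod_g[OF V(2)] prod_split[OF assms(1), of g] by (simp add: f_def assms)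
    ultimately have "l ^ 2 dvd prod g Q * g p" using coprime_dvd_mult_left_iff by blast
    moreover obtain u where u: "g p = q * u" using assms(4) by blast
    ultimately have "l ^ 2 dvd q * ((q + 1) * u)"
      using g_Q[OF V(4)] assms(3) by (simp add: mult.left_commute)
    moreover have "l \<noteq> q" using assms QW_disj by auto
    then have "coprime (l ^ 2) q" using prime_V V by (simp add: primes_coprime)
    ultimately have "l ^ 2 dvd (q + 1) * u" using coprime_dvd_mult_right_iff by blast
    moreover have "2 dvd (q + 1) * u" using odd_V[OF V(3)] by simp
    moreover have "coprime 2 (l ^ 2)" using odd_V[OF V(2)] by simp
    ultimately have "2 * l ^ 2 dvd (q + 1) * u" using divides_mult by blast
    moreover have "0 < u" using u g_pos[OF V(1)] by (cases u) auto
    ultimately have "2 * l ^ 2 \<le> (q + 1) * u" using dvd_imp_le by (metis add_gr_0 mult_pos_pos zero_less_one)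
    \<comment> \<open>Since \<open>q \<ge> 3\<close>, replacing \<open>q\<close> by
      \<open>q + 1\<close> costs at most 4/3, whereas the parity of \<open>q + 1\<close> doubled the
      lower bound.\<close>
    moreover have "3 * ((q + 1) * u) \<le> 4 * (q * u)"
      using mult_le_mono1[OF q3, of u] by (simp add: algebra_simps)
    moreover have "p * p \<le> l ^ 2" using pl by (simp add: power2_eq_square mult_le_mono)
    ultimately have "6 * (p * p) \<le> 4 * (q * u)" by linarith
    then have "6 * (p * p) \<le> 4 * (p * p + p + 1)" using u gp by metis
    moreover obtain j where "p = 3 + j" using p3 le_Suc_ex by blast
    ultimately show False by (simp add: algebra_simps)
  qed
  then obtain l' where l': "l' \<in> W - {p}" "l dvd g l'"
    using prime_dvd_prod_iff[of "W - {p}" l g] prime_V[OF V(2)] by auto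
  then have "l' \<noteq> l" using not_dvd_g[OF V(2)] by blast
  have "2 * l \<le> 3 * f l'" using l' dvd_g_le by (auto simp: W_def)
  then have "f l * (2 * l) \<le> f l * (3 * f l')" by (rule mult_le_mono2)
  moreover have "f l * (2 * l) = 2 * l ^ 3" by (simp add: f_def assms power3_eq_cube power2_eq_square)
  moreover have "f l * (3 * f l') = 3 * (f l * f l')" by simp
  moreover have "9 * (f l * f l') \<le> prod f (W - {p})"
    using prod_f_spare[OF assms(1), of "{l, l'}"] assms l' \<open>l' \<noteq> l\<close> by simp
  moreover have "p ^ 3 \<le> l ^ 3" using pl by (rule power_mono) simp
  ultimately show ?thesis by linarith
qed

theorem radical_bound_two:
  assumes "k = 2 * t" "odd t" "6 \<le> k"
  shows "\<Prod>V ^ 14 < prod f V ^ 9"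
proof -
  have cQ: "card Q \<le> 1" using card_Q_le[of 1 t] assms by simp
  have "card V = card Q + card W" using QW_un QW_disj by (metis card_Un_disjoint fin_Q fin_W)
  then have cW: "5 \<le> card W" using card_V_ge8[OF assms(3)] cQ by linarith
  show ?thesis
  proof (cases "Q = {}")
    case True
    obtain p where p: "p \<in> W" using cW by fastforce
    have "9 \<le> prod f {p}" using f_W9[OF p] by simp
    also have "\<dots> \<le> prod f V" using p by (intro prod_f_sub) (auto simp: W_def)
    finally have f9: "9 \<le> prod f V" .
    have "\<Prod>V ^ 14 = (\<Prod>V ^ 2) ^ 7" by (simp flip: power_mult)
    also have "\<dots> \<le> prod f V ^ 7"
      using square_le_if_no_simple[OF True] by (rule power_mono) simp
    also have "\<dots> < prod f V ^ 9" using f9 by (intro power_strict_increasing) auto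
    finally show ?thesis .
  next
    case False
    then have "card Q = 1" using cQ by (metis card_0_eq fin_Q le_antisym less_one linorder_not_le)
    then obtain q where Q: "Q = {q}" by (rule card_1_singletonE)
    then have q: "q \<in> Q" "\<And>x. x \<in> Q \<Longrightarrow> x \<le> q" by auto
    then obtain p where p: "p \<in> W" "q dvd g p" using Max_Q_dvd by blast
    have p3: "3 \<le> p" and q3: "3 \<le> q" using p q V_ge3 by (auto simp: W_def Q_def)
    define r where "r = prod f (W - {p})"
    have r: "\<Prod>(W - {p}) ^ 2 \<le> r" "9 \<le> r" using rest_bounds[OF p(1)] cW by (auto simp: r_def)
    have "q ^ 5 * p ^ 14 * \<Prod>(W - {p}) ^ 14 < f p ^ 9 * r ^ 9"
    proof -
      consider "e p = 2" | "e p = 3" | "4 \<le> e p" using e_W[OF p(1)] by linarith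
      then show ?thesis
      proof cases
        case 1
        note ctx = p(1) 1 q p(2)
        have "3 * p \<le> p * p" using p3 by simp
        moreover have "9 \<le> p * p" using mult_le_mono[OF p3 p3] by simp
        ultimately have "9 * q \<le> 13 * p ^ 2" using q_le[OF ctx] unfolding power2_eq_square by linarith
        then have "(9 * q) ^ 5 \<le> (13 * p ^ 2) ^ 5" by (rule power_mono) simp
        \<comment> \<open>Numerically, (13/9)^5 is below 6.3.\<close>
        then have q5: "q ^ 5 \<le> 7 * p ^ 10" by (simp add: power_mult_distrib flip: power_mult)
        have large: ?thesis if "3 * p ^ 3 \<le> r"
        proof (rule square_bound_14_9)
          have "(3 * p ^ 3) ^ 2 \<le> r ^ 2" using that by (rule power_mono) simp
          then have "9 * p ^ 6 \<le> r ^ 2" by (simp add: power_mult_distrib flip: power_mult)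
          then have r2: "p ^ 18 * (9 * p ^ 6) \<le> p ^ 18 * r ^ 2" by (rule mult_le_mono2)
          have "q ^ 5 * p ^ 14 \<le> 7 * p ^ 10 * p ^ 14" using q5 by (rule mult_le_mono1)
          also have "\<dots> = 7 * p ^ 24" by (simp flip: power_add)
          also have "\<dots> < 9 * p ^ 24" using p3 by simp
          also have "\<dots> = p ^ 18 * (9 * p ^ 6)" by (simp flip: power_add)
          also note r2
          finally show "q ^ 5 * p ^ 14 < f p ^ 9 * r ^ 2" by (simp add: f_def 1 flip: power_mult)
        qed (use r in auto)
        have "p ^ 2 dvd prod g (W - {p})"
          using square_dvd_rest[OF ctx] not_dvd_succ_q[OF ctx] Q by simp
        then obtain l where l: "l \<in> W - {p}" "p dvd g l"
          "p ^ 2 dvd g l \<or> (\<exists>l'\<in>W - {p}. l' \<noteq> l \<and> p dvd g l')"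
          using prime_square_dvd_prod[OF prime_V[OF p_V[OF ctx]], of "W - {p}" g] by auto
        \<comment> \<open>A source of \<open>p\<close> with exponent at least 3 suffices by its
          surplus. Otherwise all sources have exponent 2 and force
          \<open>3 * p ^ 3 \<le> r\<close>.\<close>
        show ?thesis
        proof (cases "\<exists>l\<in>W - {p}. 3 \<le> e l \<and> p dvd g l")
          case True
          then obtain m where m: "m \<in> W - {p}" "3 \<le> e m" "p dvd g m" by blast
          have "p ^ 2 dvd g m \<or> (\<exists>l'\<in>W - {p}. l' \<noteq> m \<and> p dvd g l')"
            using l m by (cases "m = l") auto
          then have *: "7 * p ^ 6 * \<Prod>(W - {p}) ^ 14 < r ^ 9"
            unfolding r_def using high_exponent_size[OF p(1) m] cW by blast
          have "q ^ 5 * p ^ 14 * \<Prod>(W - {p}) ^ 14 \<le> 7 * p ^ 10 * p ^ 14 * \<Prod>(W - {p}) ^ 14"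
            using q5 by (intro mult_le_mono1)
          also have "\<dots> = p ^ 18 * (7 * p ^ 6 * \<Prod>(W - {p}) ^ 14)"
            by (simp add: mult.assoc mult.left_commute flip: power_add)
          also have "\<dots> < p ^ 18 * r ^ 9" using * p3 by simp
          finally show ?thesis by (simp add: f_def 1 flip: power_mult)
        next
          case False
          then have e2: "e x = 2" if "x \<in> W - {p}" "p dvd g x" for x
            using that e_W[of x] by (metis DiffD1 Suc_leI le_neq_implies_less numeral_2_eq_2 numeral_3_eq_3)
          from l(3) show ?thesis
          proof
            assume "p ^ 2 dvd g l"
            then show ?thesis
              using square_root_size[OF p(1) 1 Q p(2) l(1) e2[OF l(1,2)]] cW large by (simp add: r_def)
          next
            assume "\<exists>l'\<in>W - {p}. l' \<noteq> l \<and> p dvd g l'"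
            then obtain l' where l': "l' \<in> W - {p}" "l' \<noteq> l" "p dvd g l'" by blast
            have "3 * p ^ 3 \<le> r"
              using two_square_roots_size[OF p(1), of l l'] two_square_roots_size[OF p(1), of l' l]
                l l' e2 cW unfolding r_def by (meson linorder_neqE_nat)
            then show ?thesis by (rule large)
          qed
        qed
      next
        case 2
        have "q ^ 5 \<le> (p ^ 2) ^ 5" using dvd_g_exponent_3[OF q(1) p 2] by (rule power_mono) simp
        then have "q ^ 5 * p ^ 14 \<le> (p ^ 2) ^ 5 * p ^ 14" by (rule mult_le_mono1)
        also have "\<dots> = p ^ 24" by (simp flip: power_mult power_add)
        also have "\<dots> < p ^ 27" using p3 by (intro power_strict_increasing) auto
        also have "\<dots> \<le> f p ^ 9 * r ^ 2" using r by (simp add: f_def 2 flip: power_mult)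
        finally show ?thesis using r by (intro square_bound_14_9) auto
      next
        case 3
        have "2 * q \<le> 3 * f p" using dvd_g_le[of p q] p by (simp add: W_def)
        then have "(2 * q) ^ 5 \<le> (3 * f p) ^ 5" by (rule power_mono) simp
        then have "q ^ 5 \<le> 8 * f p ^ 5" by (simp add: power_mult_distrib)
        moreover have "p ^ 14 \<le> p ^ (e p * 4)" using 3 p3 by (intro power_increasing) auto
        then have "p ^ 14 \<le> f p ^ 4" by (simp add: f_def power_mult)
        ultimately have "q ^ 5 * p ^ 14 \<le> 8 * f p ^ 5 * f p ^ 4" by (rule mult_le_mono)
        also have "\<dots> = 8 * f p ^ 9" by (simp flip: power_add)
        also have "\<dots> < 81 * f p ^ 9" using f_W9[OF p(1)] by simp
        also have "\<dots> \<le> f p ^ 9 * r ^ 2" using power_mono[OF r(2), of 2] by simp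
        finally show ?thesis using r by (intro square_bound_14_9) auto
      qed
    qed
    then have "(q * p * \<Prod>(W - {p})) ^ 14 < (q * f p * r) ^ 9"
      using q3 by (intro combine_powers_14_9) auto
    then show ?thesis
      using prod_split[OF p(1), of "\<lambda>x. x"] prod_split[OF p(1), of f] prod_f_Q
      by (simp add: Q r_def)
  qed
qed

end

section \<open>Passage to real exponents and to \<open>m\<close> itself\<close>

lemma less_powr_ratio:
  fixes x m M N :: nat
  assumes "x ^ N < m ^ M" "0 < N" "0 < m"
  shows "real x < real m powr (real M / real N)"
proof -
  have "real x ^ N < real m ^ M" using assms(1) by (metis of_nat_less_iff of_nat_power)
  also have "\<dots> = (real m powr (real M / real N)) ^ N"
    using assms by (simp add: powr_powr flip: powr_realpow)
  finally show ?thesis by (rule power_less_imp_less_base) simp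
qed

lemma odd_multiperfect_prime_factors:
  fixes m k :: nat
  assumes "m > 0" and "odd m" and "divisor_sum m = k * m"
  shows "odd_multiperfect (prime_factors m) (\<lambda>p. multiplicity p m) k"
proof
  have m: "(\<Prod>p\<in>prime_factors m. p ^ multiplicity p m) = m"
    using prime_factorization_nat[OF assms(1)] by simp
  show "(\<Prod>l\<in>prime_factors m. \<Sum>i\<le>multiplicity l m. l ^ i)
      = k * (\<Prod>l\<in>prime_factors m. l ^ multiplicity l m)"
    using divisor_sum_prod_prime_powers[of "prime_factors m" "\<lambda>p. multiplicity p m"] assms m
    by (simp add: in_prime_factors_imp_prime)
  fix l assume l: "l \<in> prime_factors m"
  show "prime l" using l by (simp add: in_prime_factors_imp_prime)
  show "odd l" using l assms(2) by (meson dvd_trans in_prime_factors_imp_dvd)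
  show "0 < multiplicity l m" using l by (simp add: prime_factors_multiplicity)
qed simp

theorem theorem1:
  fixes m k :: nat
  assumes "m > 0" and "odd m" and "k > 2" and "divisor_sum m = k * m"
  shows "(odd k \<longrightarrow> real (rad m) \<le> sqrt (real m))
    \<and> ([k = 2] (mod 4) \<longrightarrow> real (rad m) < real m powr (9 / 14))
    \<and> (\<forall>n t. k = 2 ^ n * t \<and> odd t \<and> n \<ge> 2 \<longrightarrow>
          real (rad m) < real m powr ((4 * real n + 1) / (4 * real n + 4)))"
proof -
  interpret odd_multiperfect "prime_factors m" "\<lambda>p. multiplicity p m" k
    using assms by (intro odd_multiperfect_prime_factors)
  have m: "prod f (prime_factors m) = m"
    unfolding f_def using prime_factorization_nat[OF assms(1)] by simp
  show ?thesis
  proof (intro conjI impI allI)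
    assume "odd k"
    \<comment> \<open>For odd \<open>k\<close> the power of two is \<open>2 ^ 0\<close>, so
      \<open>m\<close> is powerful.\<close>
    then have "card Q \<le> 0" using card_Q_le[of 0 k] by simp
    then have "rad m ^ 2 \<le> m" using square_le_if_no_simple m by (simp add: rad_def)
    then show "real (rad m) \<le> sqrt (real m)"
      by (intro real_le_rsqrt) (metis of_nat_le_iff of_nat_power)
  next
    assume "[k = 2] (mod 4)"
    then have k: "k mod 4 = 2" by (simp add: cong_def)
    \<comment> \<open>The assumption \<open>k > 2\<close> excludes 2 and raises \<open>k\<close> to
      at least 6.\<close>
    have "k = 2 * (k div 2)" "odd (k div 2)" "6 \<le> k" using k assms(3) by presburger+
    then have "rad m ^ 14 < m ^ 9" using radical_bound_two m by (simp add: rad_def)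
    then show "real (rad m) < real m powr (9 / 14)"
      using less_powr_ratio[of "rad m" 14 m 9] assms(1) by simp
  next
    fix n t assume "k = 2 ^ n * t \<and> odd t \<and> n \<ge> 2"
    then have "rad m ^ (4 * n + 4) < m ^ (4 * n + 1)"
      using radical_bound_general m by (simp add: rad_def)
    then show "real (rad m) < real m powr ((4 * real n + 1) / (4 * real n + 4))"
      using less_powr_ratio[of "rad m" "4 * n + 4" m "4 * n + 1"] assms(1) by (simp add: add_ac)
  qed
qed

end
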